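(* Let $G=(V,E)$ be a homogeneous graph on $V=\{1,\dots,m\}$ with vertices ordered so that $V\in S_H$. Let $U$ be an $m\times m$ positive definite matrix and let $\alpha\in\mathbb{R}^m$ have nonnegative entries, with $z_G(U,\alpha)<\infty$. If $\Sigma\sim\pi^{P_G}_{U,\alpha}$ and $\Sigma=LDL^T$ is its modified Cholesky decomposition, then for every $1\le i\le m$ the random variable $D_{ii}$ is independent of the submatrix $\Sigma_{\{1,2,\dots,i-1\}}=(\Sigma_{uv})_{1\le u,v\le i-1}$.
   Context: Edges are undirected, no loops. $G$ is homogeneous if for every $(i,j)\in E$, with $N[i]=\{i\}\cup\{u:(u,i)\in E\}$, either $N[j]\subseteq N[i]$ or $N[i]\subseteq N[j]$. $P_G$ is the set of $m\times m$ symmetric positive definite matrices $\Sigma$ with $\Sigma_{ij}=0$ whenever $i\ne j$ and $(i,j)\notin E$. $\mathcal{L}_G$ is the set of lower-triangular $m\times m$ matrices $L$ with unit diagonal and $L_{ij}=0$ for $i>j$, $(i,j)\notin E$. $\Theta_G=\{(L,D):L\in\mathcal{L}_G,\ D\text{ diagonal},\ D_{ii}>0\}$. The modified Cholesky decomposition of a positive definite $\Sigma$ is the unique $\Sigma=LDL^T$ with $L$ lower-triangular with unit diagonal and $D$ diagonal with positive entries. $V\in S_H$ means: (i) for every positive definite $\Sigma=LDL^T$ (modified Cholesky), $L\in\mathcal{L}_G\Leftrightarrow\Sigma\in P_G$; and (ii) for lower-triangular $L$ with unit diagonal, $L\in\mathcal{L}_G\Leftrightarrow L^{-1}\in\mathcal{L}_G$.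 Let $z_G(U,\alpha)=\int_{\Theta_G}\exp(-\frac12\{\operatorname{tr}((LDL^T)^{-1}U)+\sum_i\alpha_i\log D_{ii}\})\,dL\,dD$ with $dL\,dD=\prod_{(i,j)\in E,\,i>j}dL_{ij}\prod_i dD_{ii}$. When $z_G(U,\alpha)<\infty$, $\pi_{U,\alpha}$ is the probability distribution on $\Theta_G$ with density equal to this integrand divided by $z_G(U,\alpha)$, and $\pi^{P_G}_{U,\alpha}$ is its image on $P_G$ under $(L,D)\mapsto LDL^T$. *)

theory Defs
  imports "HOL-Probability.Probability"
begin

text \<open>
  The vertex set \<open>{1,\<dots>,m}\<close> is a finite linearly ordered type \<open>'n\<close> with \<open>m = CARD('n)\<close>; the
  class wellorder is what the library uses for ordered matrix indices, and on a finite type it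
  holds for every linear order.  An undirected graph without loops is an edge relation that is
  symmetric and irreflexive.
\<close>

text \<open>
  The type \<open>real^'n^'n\<close>, with the sort of \<open>'n\<close> left open: the infix notation would fix it to finite.
\<close>

type_synonym 'n sqmat = "((real, 'n) vec, 'n) vec"

definition closed_nbhd :: "'n rel \<Rightarrow> 'n \<Rightarrow> 'n set" where
  "closed_nbhd E i = {i} \<union> {u. (u, i) \<in> E}"

definition homogeneous_graph :: "'n rel \<Rightarrow> bool" where
  "homogeneous_graph E \<longleftrightarrow>
     (\<forall>(i, j) \<in> E. closed_nbhd E j \<subseteq> closed_nbhd E i \<or> closed_nbhd E i \<subseteq> closed_nbhd E j)"

definition pos_def :: "('n::finite) sqmat \<Rightarrow> bool" where
  "pos_def A \<longleftrightarrow> transpose A = A \<and> (\<forall>x. x \<noteq> 0 \<longrightarrow> x \<bullet> (A *v x) > 0)"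

definition cone_P :: "('n::finite) rel \<Rightarrow> 'n sqmat set" where
  "cone_P E = {A. pos_def A \<and> (\<forall>i j. i \<noteq> j \<and> (i, j) \<notin> E \<longrightarrow> A $ i $ j = 0)}"

definition unit_lower :: "('n::{finite,wellorder}) sqmat \<Rightarrow> bool" where
  "unit_lower L \<longleftrightarrow> (\<forall>i. L $ i $ i = 1) \<and> (\<forall>i j. i < j \<longrightarrow> L $ i $ j = 0)"

definition lower_L :: "('n::{finite,wellorder}) rel \<Rightarrow> 'n sqmat set" where
  "lower_L E = {L. unit_lower L \<and> (\<forall>i j. j < i \<and> (i, j) \<notin> E \<longrightarrow> L $ i $ j = 0)}"

definition pos_diagonal :: "('n::finite) sqmat \<Rightarrow> bool" where
  "pos_diagonal D \<longleftrightarrow> (\<forall>i j. i \<noteq> j \<longrightarrow> D $ i $ j = 0) \<and> (\<forall>i. D $ i $ i > 0)"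

definition Theta :: "('n::{finite,wellorder}) rel \<Rightarrow> ('n sqmat \<times> 'n sqmat) set" where
  "Theta E = {(L, D). L \<in> lower_L E \<and> pos_diagonal D}"

definition LDLt :: "('n::finite) sqmat \<times> 'n sqmat \<Rightarrow> 'n sqmat" where
  "LDLt = (\<lambda>(L, D). L ** D ** transpose L)"

definition modified_cholesky ::
    "('n::{finite,wellorder}) sqmat \<Rightarrow> 'n sqmat \<Rightarrow> 'n sqmat \<Rightarrow> bool" where
  "modified_cholesky A L D \<longleftrightarrow> unit_lower L \<and> pos_diagonal D \<and> A = LDLt (L, D)"

text \<open>
  The vertex ordering is the one of the type \<open>'n\<close>, so that membership of the ordered vertex set
  in \<open>S\<^sub>H\<close> is a property of the edge relation.
\<close>

definition in_S_H :: "('n::{finite,wellorder}) rel \<Rightarrow> bool" where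
  "in_S_H E \<longleftrightarrow>
     (\<forall>A L D. pos_def A \<and> modified_cholesky A L D \<longrightarrow> (L \<in> lower_L E \<longleftrightarrow> A \<in> cone_P E)) \<and>
     (\<forall>L. unit_lower L \<longrightarrow> (L \<in> lower_L E \<longleftrightarrow> matrix_inv L \<in> lower_L E))"

text \<open>
  The measure \<open>dL dD\<close> on \<open>\<Theta>\<^sub>G\<close> is the product of one-dimensional Lebesgue measures in the free
  coordinates \<open>L\<^sub>i\<^sub>j\<close> (with \<open>(i,j)\<close> an edge and \<open>i > j\<close>) and \<open>D\<^sub>i\<^sub>i\<close>, carried to pairs of matrices
  by filling in the prescribed entries, and restricted to \<open>D\<^sub>i\<^sub>i > 0\<close>.
\<close>

definition lower_edges :: "('n::{finite,wellorder}) rel \<Rightarrow> ('n \<times> 'n) set" where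
  "lower_edges E = {(i, j). (i, j) \<in> E \<and> j < i}"

definition fill_matrices ::
    "('n::{finite,wellorder}) rel \<Rightarrow> ('n \<times> 'n \<Rightarrow> real) \<times> ('n \<Rightarrow> real) \<Rightarrow> 'n sqmat \<times> 'n sqmat" where
  "fill_matrices E = (\<lambda>(l, d).
     (\<chi> i j. if i = j then 1 else if (i, j) \<in> lower_edges E then l (i, j) else 0,
      \<chi> i j. if i = j then d i else 0))"

definition dLdD :: "('n::{finite,wellorder}) rel \<Rightarrow> ('n sqmat \<times> 'n sqmat) measure" where
  "dLdD E = restrict_space
     (distr ((\<Pi>\<^sub>M e\<in>lower_edges E. lborel) \<Otimes>\<^sub>M (\<Pi>\<^sub>M i\<in>UNIV. lborel)) borel (fill_matrices E))
     (Theta E)"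

definition weight :: "('n::finite) sqmat \<Rightarrow> (real, 'n) vec \<Rightarrow> 'n sqmat \<times> 'n sqmat \<Rightarrow> real" where
  "weight U \<alpha> = (\<lambda>(L, D).
     exp (- (1 / 2) * (trace (matrix_inv (LDLt (L, D)) ** U) + (\<Sum>i\<in>UNIV. \<alpha> $ i * ln (D $ i $ i)))))"

definition z_G :: "('n::{finite,wellorder}) rel \<Rightarrow> 'n sqmat \<Rightarrow> (real, 'n) vec \<Rightarrow> ennreal" where
  "z_G E U \<alpha> = (\<integral>\<^sup>+ x. ennreal (weight U \<alpha> x) \<partial>dLdD E)"

definition pi_Theta ::
    "('n::{finite,wellorder}) rel \<Rightarrow> 'n sqmat \<Rightarrow> (real, 'n) vec \<Rightarrow> ('n sqmat \<times> 'n sqmat) measure" where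
  "pi_Theta E U \<alpha> = density (dLdD E) (\<lambda>x. ennreal (weight U \<alpha> x) / z_G E U \<alpha>)"

definition pi_P ::
    "('n::{finite,wellorder}) rel \<Rightarrow> 'n sqmat \<Rightarrow> (real, 'n) vec \<Rightarrow> 'n sqmat measure" where
  "pi_P E U \<alpha> = distr (pi_Theta E U \<alpha>) (restrict_space borel (cone_P E)) LDLt"

text \<open>
  Library constant indep_var wants both random variables to have the same value type.
  This is its characterization \<open>indep_var_eq\<close>, with two value types.
\<close>

definition (in prob_space) indep_rv ::
    "'b measure \<Rightarrow> ('a \<Rightarrow> 'b) \<Rightarrow> 'c measure \<Rightarrow> ('a \<Rightarrow> 'c) \<Rightarrow> bool" where
  "indep_rv S X T Y \<longleftrightarrow> random_variable S X \<and> random_variable T Y \<and>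
     indep_set (sigma_sets (space M) {X -` A \<inter> space M |A. A \<in> sets S})
               (sigma_sets (space M) {Y -` B \<inter> space M |B. B \<in> sets T})"

lemma (in prob_space) indep_rv_eq_indep_var: "indep_rv S X T Y \<longleftrightarrow> indep_var S X T Y"
  by (simp add: indep_rv_def indep_var_eq)

end

theory Submission
  imports Defs
begin

text \<open>
  Write \<open>M = L\<inverse>\<close>.  Then \<open>tr ((LDL\<^sup>T)\<inverse> U) = \<Sum>\<^sub>j (M U M\<^sup>T)\<^sub>j\<^sub>j / D\<^sub>j\<^sub>j\<close>, so in the coordinates \<open>(M, D)\<close>
  the weight is a product over \<open>j\<close> of functions of row \<open>j\<close> of \<open>M\<close> and \<open>D\<^sub>j\<^sub>j\<close>.  Since the vertices are
  ordered so that \<open>V \<in> S\<^sub>H\<close>, inversion maps the free coordinates of \<open>L\<close> to those of \<open>M\<close>; it has the form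
  \<open>M\<^sub>i\<^sub>j = - L\<^sub>i\<^sub>j + g\<close> with \<open>g\<close> a function of the \<open>L\<^sub>a\<^sub>b\<close> with \<open>[b, a]\<close> strictly inside \<open>[j, i]\<close>, hence it
  preserves Lebesgue measure.  So the pairs (row \<open>j\<close> of \<open>M\<close>, \<open>D\<^sub>j\<^sub>j\<close>) are independent for different \<open>j\<close>,
  and the leading block of \<open>\<Sigma>\<close> before \<open>i\<close> depends only on those with \<open>j < i\<close>.
\<close>

section \<open>Lebesgue measure on finite products\<close>

text \<open>A coordinate of largest key enters no shift, so it can be integrated out first: in it
  the map is affine with slope 1 or -1, and the remaining coordinates undergo a triangular map of
  the same kind.\<close>

lemma nn_integral_lborel_triangular:
  fixes c :: "'i \<Rightarrow> real" and g :: "'i \<Rightarrow> ('i \<Rightarrow> real) \<Rightarrow> real" and key :: "'i \<Rightarrow> 'k::linorder"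
  assumes "finite I"
    and "\<And>e. e \<in> I \<Longrightarrow> \<bar>c e\<bar> = 1"
    and "\<And>e. e \<in> I \<Longrightarrow> g e \<in> borel_measurable (\<Pi>\<^sub>M e\<in>I. lborel)"
    and "\<And>e x y. e \<in> I \<Longrightarrow> (\<And>e'. e' \<in> I \<Longrightarrow> key e' < key e \<Longrightarrow> x e' = y e') \<Longrightarrow> g e x = g e y"
    and "f \<in> borel_measurable (\<Pi>\<^sub>M e\<in>I. lborel)"
  shows "(\<integral>\<^sup>+ x. f (\<lambda>e\<in>I. c e * x e + g e x) \<partial>(\<Pi>\<^sub>M e\<in>I. lborel)) = (\<integral>\<^sup>+ x. f x \<partial>(\<Pi>\<^sub>M e\<in>I. lborel))"
  using assms
proof (induction I arbitrary: f rule: finite_ranking_induct[where f = key])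
  case empty
  show ?case by (rule nn_integral_cong) (auto simp: space_PiM_empty restrict_def)
next
  case (insert a I)
  show ?case
  \<comment> \<open>The ranking induction does not guarantee that \<open>a\<close> is new.\<close>
  proof (cases "a \<in> I")
    case True
    then have eq: "insert a I = I" by blast
    show ?thesis unfolding eq by (rule insert.IH[OF insert.prems[unfolded eq]])
  next
    case False
    interpret product_sigma_finite "\<lambda>_::'i. lborel :: real measure" ..
    define T where "T x = (\<lambda>e\<in>I. c e * x e + g e x)" for x
    note [measurable] = insert.prems(4)
    note gm = insert.prems(2)
    \<comment> \<open>Each \<open>g e\<close> expects a point indexed by \<open>insert a I\<close>.
      The value 0 at \<open>a\<close> is an arbitrary filler: \<open>a\<close> has the largest key,
      so no shift reads it.\<close>
    have upd [measurable]: "(\<lambda>x. x(a := 0)) \<in> measurable (\<Pi>\<^sub>M e\<in>I. lborel) (\<Pi>\<^sub>M e\<in>insert a I. lborel)"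
      by (rule measurable_fun_upd[where J = I]) auto
    have g_upd: "g e (x(a := y)) = g e x" if "e \<in> insert a I" for e x y
      using that insert.hyps(2) by (intro insert.prems(3)) force+
    have g_I [measurable]: "g e \<in> borel_measurable (\<Pi>\<^sub>M e\<in>I. lborel)" if "e \<in> insert a I" for e
    proof -
      have "(\<lambda>x. g e (x(a := 0))) \<in> borel_measurable (\<Pi>\<^sub>M e\<in>I. lborel)"
        using measurable_compose[OF upd gm[OF that]] .
      then show ?thesis by (simp add: g_upd[OF that])
    qed
    have g_agree: "g e x = g e y" if "e \<in> I" "\<And>e'. e' \<in> I \<Longrightarrow> key e' < key e \<Longrightarrow> x e' = y e'" for e x y
    proof -
      have "g e (x(a := 0)) = g e (y(a := 0))"
        using that by (intro insert.prems(3)) auto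
      then show ?thesis using that by (simp add: g_upd)
    qed
    have c_I: "\<And>e. e \<in> I \<Longrightarrow> \<bar>c e\<bar> = 1" using insert.prems(1) by simp
    have [measurable]: "T \<in> measurable (\<Pi>\<^sub>M e\<in>I. lborel) (\<Pi>\<^sub>M e\<in>I. lborel)"
      unfolding T_def using g_I by (intro measurable_restrict) simp
    have [measurable]: "(\<lambda>x. f (\<lambda>e\<in>insert a I. c e * x e + g e x))
        \<in> borel_measurable (\<Pi>\<^sub>M e\<in>insert a I. lborel)"
      using gm by (intro measurable_compose[OF measurable_restrict insert.prems(4)]) simp
    have T_upd: "(\<lambda>e\<in>insert a I. c e * (x(a := y)) e + g e (x(a := y)))
        = (T x)(a := c a * y + g a x)" for x y
      using False by (auto simp: T_def g_upd fun_eq_iff)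
    \<comment> \<open>With the other coordinates frozen, the shift is a constant \<open>t\<close>,
      and Lebesgue measure on the line is invariant under reflection and translation.\<close>
    have inner: "(\<integral>\<^sup>+ y. f (z(a := c a * y + t)) \<partial>lborel) = (\<integral>\<^sup>+ y. f (z(a := y)) \<partial>lborel)"
      if z: "z \<in> space (\<Pi>\<^sub>M e\<in>I. lborel)" for z t
    proof -
      have "(\<lambda>y. f (z(a := y))) \<in> borel_measurable lborel"
        by (rule measurable_compose[OF measurable_component_update[OF z False]]) measurable
      then have *: "(\<lambda>y. f (z(a := y))) \<in> borel_measurable borel" by simp
      have ca: "\<bar>c a\<bar> = 1" "c a \<noteq> 0" using insert.prems(1)[of a] by auto
      show ?thesis
        using nn_integral_real_affine[OF *  ca(2), of t] ca by (simp add: add.commute)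
    qed
    have "(\<integral>\<^sup>+ x. f (\<lambda>e\<in>insert a I. c e * x e + g e x) \<partial>(\<Pi>\<^sub>M e\<in>insert a I. lborel))
        = (\<integral>\<^sup>+ x. (\<integral>\<^sup>+ y. f ((T x)(a := c a * y + g a x)) \<partial>lborel) \<partial>(\<Pi>\<^sub>M e\<in>I. lborel))"
      by (subst product_nn_integral_insert[OF insert.hyps(1) False]) (measurable, simp only: T_upd)
    also have "\<dots> = (\<integral>\<^sup>+ x. (\<integral>\<^sup>+ y. f ((T x)(a := y)) \<partial>lborel) \<partial>(\<Pi>\<^sub>M e\<in>I. lborel))"
      by (intro nn_integral_cong inner) (auto simp: T_def space_PiM)
    also have "\<dots> = (\<integral>\<^sup>+ x. (\<integral>\<^sup>+ y. f (x(a := y)) \<partial>lborel) \<partial>(\<Pi>\<^sub>M e\<in>I. lborel))"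
      unfolding T_def
    proof (rule insert.IH)
      show "(\<lambda>x. \<integral>\<^sup>+ y. f (x(a := y)) \<partial>lborel) \<in> borel_measurable (\<Pi>\<^sub>M e\<in>I. lborel)"
        by measurable
      show "g e x = g e y" if "e \<in> I" "\<And>e'. e' \<in> I \<Longrightarrow> key e' < key e \<Longrightarrow> x e' = y e'" for e x y
        using that by (rule g_agree)
    qed (use c_I g_I in simp_all)
    also have "\<dots> = (\<integral>\<^sup>+ x. f x \<partial>(\<Pi>\<^sub>M e\<in>insert a I. lborel))"
      by (rule product_nn_integral_insert[OF insert.hyps(1) False, symmetric]) measurable
    finally show ?thesis .
  qed
qed

text \<open>Tonelli: \<open>F\<close> reads only the coordinates in \<open>J\<close> and at
  \<open>k\<close>, \<open>G\<close> only those in \<open>I\<close> and \<open>K\<close>. This is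
  also why \<open>F\<close> may be evaluated at the constant function \<open>\<lambda>_. t\<close>,
  which need not lie in the product space.\<close>

lemma nn_integral_lborel_split:
  fixes F G :: "('i \<Rightarrow> real) \<times> ('k \<Rightarrow> real) \<Rightarrow> ennreal"
  assumes fin: "finite I" "finite J" "finite K" and disj: "I \<inter> J = {}" and k: "k \<notin> K"
    and F [measurable]: "F \<in> borel_measurable ((\<Pi>\<^sub>M e\<in>I \<union> J. lborel) \<Otimes>\<^sub>M (\<Pi>\<^sub>M e\<in>insert k K. lborel))"
    and G [measurable]: "G \<in> borel_measurable ((\<Pi>\<^sub>M e\<in>I \<union> J. lborel) \<Otimes>\<^sub>M (\<Pi>\<^sub>M e\<in>insert k K. lborel))"
    and F_J: "\<And>l d l' d'. (\<And>e. e \<in> J \<Longrightarrow> l e = l' e) \<Longrightarrow> d k = d' k \<Longrightarrow> F (l, d) = F (l', d')"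
    and G_I: "\<And>l d l' d'. (\<And>e. e \<in> I \<Longrightarrow> l e = l' e) \<Longrightarrow> (\<And>j. j \<in> K \<Longrightarrow> d j = d' j) \<Longrightarrow> G (l, d) = G (l', d')"
  shows "(\<integral>\<^sup>+ x. F x * G x \<partial>((\<Pi>\<^sub>M e\<in>I \<union> J. lborel) \<Otimes>\<^sub>M (\<Pi>\<^sub>M e\<in>insert k K. lborel)))
    = (\<integral>\<^sup>+ y. (\<integral>\<^sup>+ t. F (y, \<lambda>_. t) \<partial>lborel) \<partial>(\<Pi>\<^sub>M e\<in>J. lborel)) * (\<integral>\<^sup>+ x. (\<integral>\<^sup>+ d. G (x, d) \<partial>(\<Pi>\<^sub>M e\<in>K. lborel)) \<partial>(\<Pi>\<^sub>M e\<in>I. lborel))"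
proof -
  interpret PI: product_sigma_finite "\<lambda>_::'i. lborel :: real measure" ..
  interpret PK: product_sigma_finite "\<lambda>_::'k. lborel :: real measure" ..
  interpret K: finite_product_sigma_finite "\<lambda>_::'k. lborel :: real measure" "insert k K" using fin by unfold_locales auto
  interpret K': finite_product_sigma_finite "\<lambda>_::'k. lborel :: real measure" K using fin by unfold_locales auto
  \<comment> \<open>Arbitrary values for the coordinates that \<open>F\<close> or \<open>G\<close>
    ignores. They complete a partial point to one of the full product, where measurability is
    assumed.\<close>
  define x0 :: "'i \<Rightarrow> real" where "x0 = (\<lambda>e\<in>I. 0)"
  define y0 :: "'i \<Rightarrow> real" where "y0 = (\<lambda>e\<in>J. 0)"
  define d0 :: "'k \<Rightarrow> real" where "d0 = (\<lambda>e\<in>K. 0)"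
  have [measurable]: "(\<lambda>y. merge I J (x0, y)) \<in> measurable (\<Pi>\<^sub>M e\<in>J. lborel) (\<Pi>\<^sub>M e\<in>I \<union> J. lborel)"
    by (rule measurable_compose[OF _ measurable_merge]) (simp add: x0_def space_PiM)
  have [measurable]: "(\<lambda>x. merge I J (x, y0)) \<in> measurable (\<Pi>\<^sub>M e\<in>I. lborel) (\<Pi>\<^sub>M e\<in>I \<union> J. lborel)"
    by (rule measurable_compose[OF _ measurable_merge]) (simp add: y0_def space_PiM)
  have [measurable]: "(\<lambda>t. d0(k := t)) \<in> measurable borel (\<Pi>\<^sub>M e\<in>insert k K. lborel)"
    using measurable_component_update[of d0 K "\<lambda>_. lborel" k] k by (simp add: d0_def space_PiM)
  have [measurable]: "(\<lambda>d. d(k := 0)) \<in> measurable (\<Pi>\<^sub>M e\<in>K. lborel) (\<Pi>\<^sub>M e\<in>insert k K. lborel)"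
    by (rule measurable_fun_upd[where J = K]) auto
  have "(\<lambda>(y, t). F (merge I J (x0, y), d0(k := t))) \<in> borel_measurable ((\<Pi>\<^sub>M e\<in>J. lborel) \<Otimes>\<^sub>M lborel)"
    by measurable
  also have "(\<lambda>(y, t). F (merge I J (x0, y), d0(k := t))) = (\<lambda>(y, t). F (y, \<lambda>_. t))"
    using disj by (intro ext) (auto intro!: F_J)
  finally have F' [measurable]: "(\<lambda>(y, t). F (y, \<lambda>_. t)) \<in> borel_measurable ((\<Pi>\<^sub>M e\<in>J. lborel) \<Otimes>\<^sub>M lborel)" .
  have "(\<lambda>(x, d). G (merge I J (x, y0), d(k := 0))) \<in> borel_measurable ((\<Pi>\<^sub>M e\<in>I. lborel) \<Otimes>\<^sub>M (\<Pi>\<^sub>M e\<in>K. lborel))"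
    by measurable
  also have "(\<lambda>(x, d). G (merge I J (x, y0), d(k := 0))) = (\<lambda>(x, d). G (x, d))"
    using disj k by (intro ext) (auto intro!: G_I)
  finally have G' [measurable]: "(\<lambda>(x, d). G (x, d)) \<in> borel_measurable ((\<Pi>\<^sub>M e\<in>I. lborel) \<Otimes>\<^sub>M (\<Pi>\<^sub>M e\<in>K. lborel))" .
  have Fm: "(\<lambda>t. F (y, \<lambda>_. t)) \<in> borel_measurable lborel" if "y \<in> space (\<Pi>\<^sub>M e\<in>J. lborel)" for y
    using measurable_Pair2[OF F' that] by simp
  have Gm: "(\<lambda>d. G (x, d)) \<in> borel_measurable (\<Pi>\<^sub>M e\<in>K. lborel)" if "x \<in> space (\<Pi>\<^sub>M e\<in>I. lborel)" for x
    using measurable_Pair2[OF G' that] by simp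
  have "(\<integral>\<^sup>+ z. F z * G z \<partial>((\<Pi>\<^sub>M e\<in>I \<union> J. lborel) \<Otimes>\<^sub>M (\<Pi>\<^sub>M e\<in>insert k K. lborel)))
    = (\<integral>\<^sup>+ l. (\<integral>\<^sup>+ d. F (l, d) * G (l, d) \<partial>(\<Pi>\<^sub>M e\<in>insert k K. lborel)) \<partial>(\<Pi>\<^sub>M e\<in>I \<union> J. lborel))"
    by (rule K.nn_integral_fst[symmetric]) measurable
  also have "\<dots> = (\<integral>\<^sup>+ l. (\<integral>\<^sup>+ d. (\<integral>\<^sup>+ t. F (l, d(k := t)) * G (l, d(k := t)) \<partial>lborel) \<partial>(\<Pi>\<^sub>M e\<in>K. lborel)) \<partial>(\<Pi>\<^sub>M e\<in>I \<union> J. lborel))"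
    using fin k by (intro nn_integral_cong PK.product_nn_integral_insert) auto
  also have "\<dots> = (\<integral>\<^sup>+ x. (\<integral>\<^sup>+ y. (\<integral>\<^sup>+ d. (\<integral>\<^sup>+ t. F (merge I J (x, y), d(k := t)) * G (merge I J (x, y), d(k := t)) \<partial>lborel) \<partial>(\<Pi>\<^sub>M e\<in>K. lborel)) \<partial>(\<Pi>\<^sub>M e\<in>J. lborel)) \<partial>(\<Pi>\<^sub>M e\<in>I. lborel))"
    using fin disj by (intro PI.product_nn_integral_fold) auto
  also have "\<dots> = (\<integral>\<^sup>+ x. (\<integral>\<^sup>+ y. (\<integral>\<^sup>+ d. (\<integral>\<^sup>+ t. F (y, \<lambda>_. t) * G (x, d) \<partial>lborel) \<partial>(\<Pi>\<^sub>M e\<in>K. lborel)) \<partial>(\<Pi>\<^sub>M e\<in>J. lborel)) \<partial>(\<Pi>\<^sub>M e\<in>I. lborel))"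
    using disj k by (intro nn_integral_cong arg_cong2[where f = "(*)"] F_J G_I) auto
  also have "\<dots> = (\<integral>\<^sup>+ x. (\<integral>\<^sup>+ y. (\<integral>\<^sup>+ t. F (y, \<lambda>_. t) \<partial>lborel) * (\<integral>\<^sup>+ d. G (x, d) \<partial>(\<Pi>\<^sub>M e\<in>K. lborel)) \<partial>(\<Pi>\<^sub>M e\<in>J. lborel)) \<partial>(\<Pi>\<^sub>M e\<in>I. lborel))"
    by (intro nn_integral_cong) (simp add: nn_integral_cmult nn_integral_multc Fm Gm)
  also have "\<dots> = (\<integral>\<^sup>+ y. (\<integral>\<^sup>+ t. F (y, \<lambda>_. t) \<partial>lborel) \<partial>(\<Pi>\<^sub>M e\<in>J. lborel)) * (\<integral>\<^sup>+ x. (\<integral>\<^sup>+ d. G (x, d) \<partial>(\<Pi>\<^sub>M e\<in>K. lborel)) \<partial>(\<Pi>\<^sub>M e\<in>I. lborel))"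
    by (simp add: nn_integral_cmult nn_integral_multc)
  finally show ?thesis .
qed

section \<open>Unit lower triangular matrices and the modified Cholesky decomposition\<close>

lemma sum_eq_diag_lower:
  fixes f :: "'n::{finite,wellorder} \<Rightarrow> real"
  assumes "\<And>k. j < k \<Longrightarrow> f k = 0"
  shows "sum f UNIV = f j + sum f {..<j}"
proof -
  have "sum f UNIV = sum f (insert j {..<j})"
    using assms by (intro sum.mono_neutral_right) (auto, metis linorder_less_linear)
  then show ?thesis by simp
qed

lemma unit_lower_invertible:
  assumes "unit_lower L"
  shows "invertible L"
proof -
  have "det L = (\<Prod>i\<in>UNIV. L $ i $ i)"
    using assms by (intro det_lowerdiagonal) (auto simp: unit_lower_def)
  then show ?thesis
    using assms by (simp add: unit_lower_def invertible_det_nz)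
qed

lemma matrix_inv_invertible:
  fixes A :: "('n::finite) sqmat"
  assumes "invertible A"
  shows matrix_inv_right: "A ** matrix_inv A = mat 1" and matrix_inv_left: "matrix_inv A ** A = mat 1"
proof -
  have "A ** matrix_inv A = mat 1 \<and> matrix_inv A ** A = mat 1"
    using assms unfolding matrix_inv_def invertible_def by (rule someI_ex)
  then show "A ** matrix_inv A = mat 1" "matrix_inv A ** A = mat 1" by auto
qed

lemma matrix_inv_eqI:
  fixes A :: "('n::finite) sqmat"
  assumes "A ** B = mat 1"
  shows "matrix_inv A = B"
proof -
  have "invertible A" using assms invertible_right_inverse by blast
  then have "matrix_inv A ** A = mat 1" by (rule matrix_inv_left)
  then have "matrix_inv A = matrix_inv A ** (A ** B)" using assms by simp
  also have "\<dots> = B" by (simp add: matrix_mul_assoc \<open>matrix_inv A ** A = mat 1\<close>)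
  finally show ?thesis .
qed

text \<open>Forward substitution: row \<open>j\<close> of \<open>L ** matrix_inv L = mat 1\<close>,
  solved for the term whose coefficient is the unit diagonal entry. It replaces the choice in
  \<open>matrix_inv\<close> by a recursion over earlier rows.\<close>

lemma matrix_inv_unit_lower_nth:
  assumes "unit_lower L"
  shows "matrix_inv L $ j $ l = (if j = l then 1 else 0) - (\<Sum>k<j. L $ j $ k * matrix_inv L $ k $ l)"
proof -
  have "(L ** matrix_inv L) $ j $ l = (if j = l then 1 else 0)"
    using unit_lower_invertible[OF assms] by (simp add: matrix_inv_right mat_def)
  moreover have "(L ** matrix_inv L) $ j $ l = matrix_inv L $ j $ l + (\<Sum>k<j. L $ j $ k * matrix_inv L $ k $ l)"
    using assms unfolding matrix_matrix_mult_def by (simp add: sum_eq_diag_lower[where j = j] unit_lower_def)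
  ultimately show ?thesis by simp
qed

lemma unit_lower_matrix_inv:
  assumes "unit_lower L"
  shows "unit_lower (matrix_inv L)"
proof -
  have "matrix_inv L $ j $ l = (if j = l then 1 else 0)" if "j \<le> l" for j l
    using that
  proof (induction j rule: less_induct)
    case (less j)
    then show ?case
      by (subst matrix_inv_unit_lower_nth[OF assms]) (auto intro!: sum.neutral)
  qed
  then show ?thesis by (auto simp: unit_lower_def)
qed

text \<open>In the forward substitution the terms with \<open>k < l\<close> vanish, and at
  \<open>k = l\<close> the inverse has entry 1. What is left is affine in \<open>L $ j $ l\<close>
  with slope -1.\<close>

lemma matrix_inv_unit_lower_below:
  assumes "unit_lower L" "l < j"
  shows "matrix_inv L $ j $ l = - L $ j $ l - (\<Sum>k\<in>{l<..<j}. L $ j $ k * matrix_inv L $ k $ l)"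
proof -
  note M = unit_lower_matrix_inv[OF assms(1)]
  have "(\<Sum>k<j. L $ j $ k * matrix_inv L $ k $ l) = (\<Sum>k\<in>insert l {l<..<j}. L $ j $ k * matrix_inv L $ k $ l)"
    using M assms(2) by (intro sum.mono_neutral_right) (auto simp: unit_lower_def)
  then show ?thesis
    using matrix_inv_unit_lower_nth[OF assms(1), of j l] M assms(2) by (simp add: unit_lower_def)
qed

text \<open>The recursion for entry \<open>(j, l)\<close> reads only rows up to \<open>j\<close> and
  columns from \<open>l\<close> on. This serves both for the triangular form of inversion and to see
  that the rows of the inverse before \<open>i\<close> ignore row \<open>i\<close>.\<close>

lemma matrix_inv_unit_lower_cong:
  assumes "unit_lower L" "unit_lower L'"
    and "\<And>a b. l \<le> b \<Longrightarrow> b < a \<Longrightarrow> a \<le> j \<Longrightarrow> L $ a $ b = L' $ a $ b"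
  shows "matrix_inv L $ j $ l = matrix_inv L' $ j $ l"
  using assms(3)
proof (induction j rule: less_induct)
  case (less j)
  note M = unit_lower_matrix_inv[OF assms(1)] unit_lower_matrix_inv[OF assms(2)]
  show ?case
  proof (cases "l < j")
    case True
    have "matrix_inv L $ k $ l = matrix_inv L' $ k $ l" if "k \<in> {l<..<j}" for k
      using that by (intro less.IH less.prems) auto
    then show ?thesis
      unfolding matrix_inv_unit_lower_below[OF assms(1) True] matrix_inv_unit_lower_below[OF assms(2) True]
      using True less.prems by (intro arg_cong2[where f = "(-)"] sum.cong arg_cong2[where f = "(*)"]) auto
  next
    case False
    then have "j = l \<or> j < l" by auto
    then show ?thesis using M by (auto simp: unit_lower_def)
  qed
qed

section \<open>The product of the Cholesky factors and the recovery of its diagonal\<close>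

lemma LDLt_nth:
  assumes "\<And>i j. i \<noteq> j \<Longrightarrow> D $ i $ j = 0"
  shows "LDLt (L, D) $ u $ v = (\<Sum>k\<in>UNIV. L $ u $ k * D $ k $ k * L $ v $ k)"
proof -
  have "(L ** D) $ u $ k = L $ u $ k * D $ k $ k" for k
  proof -
    have "(L ** D) $ u $ k = (\<Sum>j\<in>UNIV. if j = k then L $ u $ k * D $ k $ k else 0)"
      unfolding matrix_matrix_mult_def vec_lambda_beta
      using assms by (intro sum.cong) auto
    then show ?thesis by simp
  qed
  then have "(L ** D ** transpose L) $ u $ v = (\<Sum>k\<in>UNIV. L $ u $ k * D $ k $ k * L $ v $ k)"
    unfolding matrix_matrix_mult_def[of "L ** D"] by (simp add: transpose_def)
  then show ?thesis by (simp add: LDLt_def)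
qed

lemma pos_diagonal_offdiag: "pos_diagonal D \<Longrightarrow> i \<noteq> j \<Longrightarrow> D $ i $ j = 0"
  by (simp add: pos_diagonal_def)

text \<open>The substitution \<open>y = transpose L *v x\<close> diagonalizes the quadratic form,
  and invertibility of \<open>L\<close> keeps \<open>y\<close> nonzero.\<close>

lemma pos_def_LDLt:
  assumes L: "unit_lower L" and D: "pos_diagonal D"
  shows "pos_def (LDLt (L, D))"
  unfolding pos_def_def
proof (intro conjI allI impI)
  show "transpose (LDLt (L, D)) = LDLt (L, D)"
    by (simp add: vec_eq_iff transpose_def LDLt_nth[OF pos_diagonal_offdiag[OF D]] mult_ac)
  fix x :: "(real, 'a) vec"
  assume "x \<noteq> 0"
  define y where "y = transpose L *v x"
  have "x \<bullet> (LDLt (L, D) *v x) = y \<bullet> (D *v y)"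
    by (simp add: LDLt_def y_def dot_lmul_matrix[symmetric] matrix_vector_mul_assoc[symmetric]) 
  also have "\<dots> = (\<Sum>k\<in>UNIV. D $ k $ k * (y $ k)\<^sup>2)"
  proof -
    have "(D *v y) $ k = D $ k $ k * y $ k" for k
    proof -
      have "(D *v y) $ k = (\<Sum>j\<in>UNIV. if j = k then D $ k $ k * y $ k else 0)"
        unfolding matrix_vector_mult_def vec_lambda_beta
        using D by (intro sum.cong) (auto simp: pos_diagonal_def)
      then show ?thesis by simp
    qed
    then show ?thesis by (simp add: inner_vec_def power2_eq_square mult_ac)
  qed
  finally have eq: "x \<bullet> (LDLt (L, D) *v x) = (\<Sum>k\<in>UNIV. D $ k $ k * (y $ k)\<^sup>2)" .
  have "y \<noteq> 0"
  proof
    assume "y = 0"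
    have "invertible (transpose L)"
      using unit_lower_invertible[OF L] by (simp add: invertible_det_nz)
    then have "matrix_inv (transpose L) *v y = x"
      unfolding y_def by (simp only: matrix_vector_mul_assoc matrix_inv_left matrix_vector_mul_lid)
    with \<open>y = 0\<close> \<open>x \<noteq> 0\<close> show False by simp
  qed
  then obtain k where "y $ k \<noteq> 0" by (auto simp: vec_eq_iff)
  have "0 < (\<Sum>k\<in>UNIV. D $ k $ k * (y $ k)\<^sup>2)"
    using D \<open>y $ k \<noteq> 0\<close> by (intro sum_pos2[of _ k]) (auto simp: pos_diagonal_def less_imp_le)
  with eq show "x \<bullet> (LDLt (L, D) *v x) > 0" by simp
qed

text \<open>One step of Gaussian elimination per column: for \<open>A = LDL\<^sup>T\<close> this is the matrix \<open>LD\<close>.\<close>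

function ldl_column :: "('n::{finite,wellorder}) sqmat \<Rightarrow> 'n \<Rightarrow> 'n \<Rightarrow> real" where
  "ldl_column A i j = A $ i $ j - (\<Sum>k<j. ldl_column A i k * ldl_column A j k / ldl_column A k k)"
  by auto
termination
  by (relation "inv_image {(x, y). x < y} (\<lambda>(A, i, j). j)") (auto intro: wf)

declare ldl_column.simps [simp del]

text \<open>In the expansion of \<open>A $ i $ j\<close> the term \<open>k = j\<close> is the
  claimed product, since \<open>L $ j $ j = 1\<close>; the earlier terms are known by induction. For
  \<open>i = j\<close> this exhibits \<open>D $ i $ i\<close> as an explicit function of
  \<open>A\<close>.\<close>

lemma ldl_column_LDLt:
  assumes "modified_cholesky A L D"
  shows "ldl_column A i j = L $ i $ j * D $ j $ j"
proof (induction j arbitrary: i rule: less_induct)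
  case (less j)
  have L: "unit_lower L" and D: "pos_diagonal D" and A: "A = LDLt (L, D)"
    using assms by (auto simp: modified_cholesky_def)
  have D0: "D $ k $ k \<noteq> 0" for k using D unfolding pos_diagonal_def by (metis less_irrefl)
  have "A $ i $ j = L $ i $ j * D $ j $ j + (\<Sum>k<j. L $ i $ k * D $ k $ k * L $ j $ k)"
    using L by (simp add: A LDLt_nth[OF pos_diagonal_offdiag[OF D]] sum_eq_diag_lower[where j = j] unit_lower_def)
  \<comment> \<open>The pivot \<open>ldl_column A k k\<close> is \<open>D $ k $ k\<close>, which is
    nonzero, so the quotient cancels one of two such factors.\<close>
  moreover have "(\<Sum>k<j. ldl_column A i k * ldl_column A j k / ldl_column A k k)
      = (\<Sum>k<j. L $ i $ k * D $ k $ k * L $ j $ k)"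
    using L D0 by (intro sum.cong) (auto simp: less.IH unit_lower_def)
  ultimately show ?case by (simp add: ldl_column.simps[of A i j])
qed

section \<open>Borel measurability and the exponent of the weight\<close>

lemma borel_measurable_vec_nth [measurable (raw)]:
  fixes f :: "'a \<Rightarrow> ('b::euclidean_space, 'n::finite) vec"
  assumes "f \<in> borel_measurable M"
  shows "(\<lambda>x. f x $ i) \<in> borel_measurable M"
  by (rule measurable_compose[OF assms borel_measurable_continuous_onI]) (intro continuous_intros)

lemma borel_measurable_vec_lambda:
  fixes f :: "'a \<Rightarrow> 'n::finite \<Rightarrow> 'b::euclidean_space"
  assumes [measurable]: "\<And>i. (\<lambda>x. f x i) \<in> borel_measurable M"
  shows "(\<lambda>x. \<chi> i. f x i) \<in> borel_measurable M"
  by (subst borel_measurable_euclidean_space) (auto simp: Basis_vec_def inner_axis)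

text \<open>Valid on all matrices, also where a pivot vanishes, because division by zero is defined
  to give zero.\<close>

lemma ldl_column_measurable: "(\<lambda>A. ldl_column A i j) \<in> borel_measurable borel"
proof (induction j arbitrary: i rule: less_induct)
  case (less j)
  then show ?case
    by (subst ldl_column.simps) (auto intro!: borel_measurable_diff borel_measurable_sum borel_measurable_divide borel_measurable_times)
qed

text \<open>Here \<open>L\<close> stands for the inverse of the Cholesky factor. The inverted
  product is then \<open>L^T D^(-1) L\<close>, and cyclicity of the trace moves \<open>L^T\<close>
  to the right end.\<close>

lemma trace_LDLt_inverse:
  assumes L: "unit_lower L" and D: "pos_diagonal D"
  shows "trace (matrix_inv (LDLt (matrix_inv L, D)) ** U) = (\<Sum>j\<in>UNIV. (L ** U ** transpose L) $ j $ j / D $ j $ j)"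
proof -
  define D' :: "'a sqmat" where "D' = (\<chi> i j. if i = j then 1 / D $ i $ i else 0)"
  have D0: "D $ k $ k \<noteq> 0" for k using D unfolding pos_diagonal_def by (metis less_irrefl)
  have DD': "D ** D' = mat 1"
  proof -
    have "(D ** D') $ u $ v = mat 1 $ u $ v" for u v
    proof -
      have "(D ** D') $ u $ v = (\<Sum>j\<in>UNIV. if j = v then D $ u $ v * (1 / D $ v $ v) else 0)"
        unfolding matrix_matrix_mult_def vec_lambda_beta
        by (intro sum.cong) (auto simp: D'_def)
      also have "\<dots> = mat 1 $ u $ v"
        using D D0 by (auto simp: mat_def pos_diagonal_def)
      finally show ?thesis .
    qed
    then show ?thesis by (simp add: vec_eq_iff)
  qed
  let ?M = "matrix_inv L"
  have LM: "?M ** L = mat 1"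
    by (rule matrix_inv_left[OF unit_lower_invertible[OF L]])
  have MtLt: "transpose ?M ** transpose L = mat 1"
    by (metis LM matrix_left_right_inverse matrix_transpose_mul transpose_mat)
  have "LDLt (?M, D) ** (transpose L ** D' ** L) = ?M ** D ** (transpose ?M ** transpose L) ** D' ** L"
    by (simp add: LDLt_def matrix_mul_assoc)
  also have "\<dots> = ?M ** (D ** D') ** L" by (simp add: MtLt matrix_mul_assoc)
  also have "\<dots> = mat 1" by (simp add: DD' LM)
  finally have "matrix_inv (LDLt (?M, D)) = transpose L ** D' ** L" by (rule matrix_inv_eqI)
  then have "trace (matrix_inv (LDLt (?M, D)) ** U) = trace (transpose L ** (D' ** L ** U))"
    by (simp add: matrix_mul_assoc)
  also have "\<dots> = trace (D' ** (L ** U ** transpose L))"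
    by (subst trace_mul_sym) (simp add: matrix_mul_assoc)
  also have "\<dots> = (\<Sum>j\<in>UNIV. (L ** U ** transpose L) $ j $ j / D $ j $ j)"
  proof -
    have "(D' ** X) $ j $ j = X $ j $ j / D $ j $ j" for X :: "'a sqmat" and j
    proof -
      have "(D' ** X) $ j $ j = (\<Sum>k\<in>UNIV. if k = j then X $ j $ j / D $ j $ j else 0)"
        unfolding matrix_matrix_mult_def vec_lambda_beta
        by (intro sum.cong) (auto simp: D'_def)
      then show ?thesis by simp
    qed
    then show ?thesis by (simp add: trace_def)
  qed
  finally show ?thesis .
qed

lemma matrix_inv_matrix_inv:
  fixes A :: "('n::finite) sqmat"
  assumes "invertible A"
  shows "matrix_inv (matrix_inv A) = A"
  by (rule matrix_inv_eqI) (rule matrix_inv_left[OF assms])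

text \<open>Since \<open>matrix_inv\<close> is defined by choice, measurability is read off from
  forward substitution, row by row.\<close>

lemma matrix_inv_unit_lower_measurable:
  fixes f :: "'a \<Rightarrow> ('n::{finite,wellorder}) sqmat"
  assumes [measurable]: "f \<in> borel_measurable M"
    and lower: "\<And>x. x \<in> space M \<Longrightarrow> unit_lower (f x)"
  shows "(\<lambda>x. matrix_inv (f x) $ j $ l) \<in> borel_measurable M"
proof (induction j rule: less_induct)
  case (less j)
  have "(\<lambda>x. (if j = l then 1 else 0) - (\<Sum>k<j. f x $ j $ k * matrix_inv (f x) $ k $ l)) \<in> borel_measurable M"
    using less by (intro borel_measurable_diff borel_measurable_sum borel_measurable_times) auto
  then show ?case
    by (subst measurable_cong[OF matrix_inv_unit_lower_nth[OF lower]])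
qed

text \<open>The matrix inverted in \<open>weight\<close> is not triangular in general, so the trace
  is first rewritten through the inverse of the triangular factor.\<close>

lemma weight_measurable:
  fixes f :: "'a \<Rightarrow> ('n::{finite,wellorder}) sqmat \<times> 'n sqmat"
  assumes [measurable]: "f \<in> borel_measurable M"
    and Theta: "\<And>x. x \<in> space M \<Longrightarrow> f x \<in> Theta E"
  shows "(\<lambda>x. weight U \<alpha> (f x)) \<in> borel_measurable M"
proof -
  have f1 [measurable]: "(\<lambda>x. fst (f x)) \<in> borel_measurable M" and f2 [measurable]: "(\<lambda>x. snd (f x)) \<in> borel_measurable M"
    by (auto intro!: measurable_compose[OF assms(1) borel_measurable_continuous_onI] continuous_intros)
  have L: "unit_lower (fst (f x))" and D: "pos_diagonal (snd (f x))" if "x \<in> space M" for x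
    using Theta[OF that] by (auto simp: Theta_def lower_L_def)
  note [measurable] = matrix_inv_unit_lower_measurable[OF f1 L]
  let ?M = "\<lambda>x. matrix_inv (fst (f x))"
  have "(\<lambda>x. exp (- (1 / 2) * ((\<Sum>j\<in>UNIV. (\<Sum>k\<in>UNIV. (\<Sum>m\<in>UNIV. ?M x $ j $ m * U $ m $ k) * ?M x $ j $ k) / snd (f x) $ j $ j)
      + (\<Sum>i\<in>UNIV. \<alpha> $ i * ln (snd (f x) $ i $ i))))) \<in> borel_measurable M"
    by measurable
  also have "?this \<longleftrightarrow> ?thesis"
  proof (rule measurable_cong)
    fix x assume x: "x \<in> space M"
    \<comment> \<open>Inverting twice brings \<open>f x\<close> into the shape of
      \<open>trace_LDLt_inverse\<close>, with \<open>?M x\<close> in the role of its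
      \<open>L\<close>.\<close>
    have "f x = (matrix_inv (?M x), snd (f x))"
      using matrix_inv_matrix_inv[OF unit_lower_invertible[OF L[OF x]]] by (simp add: prod_eq_iff)
    then show "exp (- (1 / 2) * ((\<Sum>j\<in>UNIV. (\<Sum>k\<in>UNIV. (\<Sum>m\<in>UNIV. ?M x $ j $ m * U $ m $ k) * ?M x $ j $ k) / snd (f x) $ j $ j)
      + (\<Sum>i\<in>UNIV. \<alpha> $ i * ln (snd (f x) $ i $ i)))) = weight U \<alpha> (f x)"
      using trace_LDLt_inverse[OF unit_lower_matrix_inv[OF L[OF x]] D[OF x], of U]
      by (auto simp: weight_def matrix_matrix_mult_def transpose_def split_beta)
  qed
  finally show ?thesis .
qed

section \<open>The distribution in the coordinates of the inverse factor\<close>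

text \<open>The triangular component of \<open>fill_matrices\<close>, kept apart because inversion
  acts on it alone. Its argument holds the free coordinates of the factor or those of its
  inverse.\<close>

definition tri_of :: "('n::{finite,wellorder}) rel \<Rightarrow> ('n \<times> 'n \<Rightarrow> real) \<Rightarrow> 'n sqmat" where
  "tri_of E l = (\<chi> i j. if i = j then 1 else if (i, j) \<in> lower_edges E then l (i, j) else 0)"

definition diag_of :: "('n::finite \<Rightarrow> real) \<Rightarrow> 'n sqmat" where
  "diag_of d = (\<chi> i j. if i = j then d i else 0)"

definition inverse_coords :: "('n::{finite,wellorder}) rel \<Rightarrow> ('n \<times> 'n \<Rightarrow> real) \<Rightarrow> 'n \<times> 'n \<Rightarrow> real" where
  "inverse_coords E l = (\<lambda>e\<in>lower_edges E. matrix_inv (tri_of E l) $ fst e $ snd e)"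

lemma fill_matrices_eq: "fill_matrices E (l, d) = (tri_of E l, diag_of d)"
  by (simp add: fill_matrices_def tri_of_def diag_of_def)

lemma unit_lower_tri_of: "unit_lower (tri_of E l)"
  by (auto simp: unit_lower_def tri_of_def lower_edges_def)

lemma tri_of_in_lower_L: "tri_of E l \<in> lower_L E"
  using unit_lower_tri_of[of E l] by (auto simp: lower_L_def tri_of_def lower_edges_def)

lemma fill_matrices_in_Theta_iff: "fill_matrices E (l, d) \<in> Theta E \<longleftrightarrow> (\<forall>j. 0 < d j)"
  by (auto simp: fill_matrices_eq Theta_def tri_of_in_lower_L pos_diagonal_def diag_of_def)

text \<open>By condition (ii) of \<open>in_S_H\<close> the inverse has the same zero pattern, so
  keeping only its entries at \<open>lower_edges E\<close> loses nothing.\<close>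

lemma tri_of_inverse_coords:
  assumes "in_S_H E"
  shows "tri_of E (inverse_coords E l) = matrix_inv (tri_of E l)"
proof -
  have "matrix_inv (tri_of E l) \<in> lower_L E"
    using assms tri_of_in_lower_L[of E l] unit_lower_tri_of[of E l] by (auto simp: in_S_H_def)
  then have "tri_of E (inverse_coords E l) $ i $ j = matrix_inv (tri_of E l) $ i $ j" for i j
    by (auto simp: tri_of_def inverse_coords_def lower_L_def unit_lower_def lower_edges_def neq_iff)
  then show ?thesis by (simp add: vec_eq_iff)
qed

lemma tri_of_measurable [measurable]:
  "tri_of E \<in> borel_measurable (\<Pi>\<^sub>M e\<in>lower_edges E. lborel)"
  unfolding tri_of_def
proof (intro borel_measurable_vec_lambda)
  fix i j
  show "(\<lambda>l. if i = j then 1 else if (i, j) \<in> lower_edges E then l (i, j) else 0)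
      \<in> borel_measurable (\<Pi>\<^sub>M e\<in>lower_edges E. (lborel :: real measure))"
    by (cases "i = j"; cases "(i, j) \<in> lower_edges E") simp_all
qed

lemma diag_of_measurable [measurable]:
  "diag_of \<in> borel_measurable (\<Pi>\<^sub>M j\<in>UNIV. lborel)"
  unfolding diag_of_def
  by (intro borel_measurable_vec_lambda) auto

lemma matrix_inv_tri_of_measurable [measurable]:
  "(\<lambda>l. matrix_inv (tri_of E l) $ i $ j) \<in> borel_measurable (\<Pi>\<^sub>M e\<in>lower_edges E. lborel)"
  by (rule matrix_inv_unit_lower_measurable[OF tri_of_measurable unit_lower_tri_of])

lemma inverse_coords_measurable [measurable]:
  "inverse_coords E \<in> measurable (\<Pi>\<^sub>M e\<in>lower_edges E. lborel) (\<Pi>\<^sub>M e\<in>lower_edges E. lborel)"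
  unfolding inverse_coords_def by measurable

text \<open>By \<open>matrix_inv_unit_lower_below\<close> each coordinate of the inverse is minus
  the original one plus a shift reading only entries with strictly smaller \<open>key\<close>, so
  \<open>nn_integral_lborel_triangular\<close> applies with slope -1.\<close>

lemma nn_integral_inverse_coords:
  fixes E :: "('n::{finite,wellorder}) rel"
  assumes "f \<in> borel_measurable (\<Pi>\<^sub>M e\<in>lower_edges E. lborel)"
  shows "(\<integral>\<^sup>+ l. f (inverse_coords E l) \<partial>(\<Pi>\<^sub>M e\<in>lower_edges E. lborel)) = (\<integral>\<^sup>+ l. f l \<partial>(\<Pi>\<^sub>M e\<in>lower_edges E. lborel))"
proof -
  define g :: "'n \<times> 'n \<Rightarrow> ('n \<times> 'n \<Rightarrow> real) \<Rightarrow> real" where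
    "g e l = - (\<Sum>k\<in>{snd e<..<fst e}. tri_of E l $ fst e $ k * matrix_inv (tri_of E l) $ k $ snd e)" for e l
  \<comment> \<open>\<open>card {j<..i}\<close> orders the coordinates so that the inversion is triangular\<close>
  define key :: "'n \<times> 'n \<Rightarrow> nat" where "key e = card {snd e<..fst e}" for e
  have key_less: "key (a, b) < key (i, j)" if "b < a" "j \<le> b" "a \<le> i" "(a, b) \<noteq> (i, j)" for a b i j
  proof -
    have "{b<..a} \<subseteq> {j<..i}" using that by auto
    \<comment> \<open>A point showing strictness: if \<open>b = j\<close>, then \<open>a < i\<close>
      and \<open>i\<close> is missed; otherwise \<open>b\<close> is missed, the interval being open
      on the left.\<close>
    moreover have "(if b = j then i else b) \<in> {j<..i} - {b<..a}" using that by auto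
    ultimately have "{b<..a} \<subset> {j<..i}" by blast
    then show ?thesis unfolding key_def by (intro psubset_card_mono) auto
  qed
  have "inverse_coords E l = (\<lambda>e\<in>lower_edges E. (-1) * l e + g e l)" for l
    by (auto simp: inverse_coords_def fun_eq_iff lower_edges_def g_def
        matrix_inv_unit_lower_below[OF unit_lower_tri_of])
       (auto simp: tri_of_def lower_edges_def)
  moreover have "(\<integral>\<^sup>+ l. f (\<lambda>e\<in>lower_edges E. (-1) * l e + g e l) \<partial>(\<Pi>\<^sub>M e\<in>lower_edges E. lborel))
      = (\<integral>\<^sup>+ l. f l \<partial>(\<Pi>\<^sub>M e\<in>lower_edges E. lborel))"
  proof (rule nn_integral_lborel_triangular[where key = key])
    show "g e \<in> borel_measurable (\<Pi>\<^sub>M e\<in>lower_edges E. lborel)" for e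
      unfolding g_def by measurable
    fix e and x y :: "'n \<times> 'n \<Rightarrow> real"
    assume "e \<in> lower_edges E" and eq: "\<And>e'. e' \<in> lower_edges E \<Longrightarrow> key e' < key e \<Longrightarrow> x e' = y e'"
    obtain i j where e: "e = (i, j)" by force
    have tri: "tri_of E x $ a $ b = tri_of E y $ a $ b" if "j \<le> b" "a \<le> i" "(a, b) \<noteq> (i, j)" for a b
      using that eq[of "(a, b)"] key_less[of b a j i] by (auto simp: tri_of_def lower_edges_def e)
    \<comment> \<open>Entry \<open>(k, j)\<close> reads rows up to \<open>k < i\<close> only, hence
      never the position \<open>(i, j)\<close> itself.\<close>
    have "matrix_inv (tri_of E x) $ k $ j = matrix_inv (tri_of E y) $ k $ j" if "k < i" for k
      using that by (intro matrix_inv_unit_lower_cong unit_lower_tri_of tri) auto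
    then show "g e x = g e y"
      unfolding g_def e by (intro arg_cong[where f = uminus] sum.cong arg_cong2[where f = "(*)"] tri) auto
  qed (use assms in auto)
  ultimately show ?thesis by simp
qed

section \<open>From the factor space to the cone\<close>

lemma Theta_borel [measurable]: "Theta E \<in> sets borel"
proof -
  have [measurable]: "(fst :: 'a sqmat \<times> 'a sqmat \<Rightarrow> _) \<in> borel_measurable borel" "(snd :: 'a sqmat \<times> 'a sqmat \<Rightarrow> _) \<in> borel_measurable borel"
    by (auto intro!: borel_measurable_continuous_onI continuous_intros)
  have "Theta E = {x \<in> space borel. ((\<forall>i. fst x $ i $ i = 1) \<and> (\<forall>i j. i < j \<longrightarrow> fst x $ i $ j = 0)) \<and>
      (\<forall>i j. j < i \<and> (i, j) \<notin> E \<longrightarrow> fst x $ i $ j = 0) \<and>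
      (\<forall>i j. i \<noteq> j \<longrightarrow> snd x $ i $ j = 0) \<and> (\<forall>i. 0 < snd x $ i $ i)}"
    by (auto simp: Theta_def lower_L_def unit_lower_def pos_diagonal_def)
  also have "\<dots> \<in> sets borel" by measurable
  finally show ?thesis .
qed

text \<open>Condition (i) of \<open>in_S_H\<close>, applied to the product with its own
  decomposition. It makes \<open>LDLt\<close> a map into the space that carries
  \<open>pi_P\<close>.\<close>

lemma LDLt_in_cone_P:
  assumes "in_S_H E" and "(L, D) \<in> Theta E"
  shows "LDLt (L, D) \<in> cone_P E"
proof -
  have "L \<in> lower_L E" "unit_lower L" "pos_diagonal D" using assms(2) by (auto simp: Theta_def lower_L_def)
  then have "pos_def (LDLt (L, D))" "modified_cholesky (LDLt (L, D)) L D"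
    by (auto simp: pos_def_LDLt modified_cholesky_def)
  with assms(1) \<open>L \<in> lower_L E\<close> show ?thesis unfolding in_S_H_def by blast
qed

lemma LDLt_borel_measurable: "LDLt \<in> borel_measurable borel"
proof -
  have "(\<lambda>x. (\<chi> i j. \<Sum>k\<in>UNIV. (\<Sum>m\<in>UNIV. fst x $ i $ m * snd x $ m $ k) * fst x $ j $ k) :: 'a sqmat) \<in> borel_measurable borel"
    by (intro borel_measurable_continuous_onI continuous_intros)
  also have "(\<lambda>x. (\<chi> i j. \<Sum>k\<in>UNIV. (\<Sum>m\<in>UNIV. fst x $ i $ m * snd x $ m $ k) * fst x $ j $ k) :: 'a sqmat) = LDLt"
    by (auto simp: LDLt_def matrix_matrix_mult_def transpose_def fun_eq_iff)
  finally show ?thesis .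
qed

text \<open>Here \<open>l\<close> holds the coordinates of \<open>L\<inverse>\<close>, not of \<open>L\<close>.\<close>

definition row_factor ::
    "('n::{finite,wellorder}) rel \<Rightarrow> 'n sqmat \<Rightarrow> (real, 'n) vec \<Rightarrow> 'n \<Rightarrow> ('n \<times> 'n \<Rightarrow> real) \<times> ('n \<Rightarrow> real) \<Rightarrow> ennreal" where
  "row_factor E U \<alpha> j = (\<lambda>(l, d). indicator {0<..} (d j) *
     ennreal (exp (- (1 / 2) * ((tri_of E l ** U ** transpose (tri_of E l)) $ j $ j / d j + \<alpha> $ j * ln (d j)))))"

lemma row_factor_measurable [measurable]:
  "row_factor E U \<alpha> j \<in> borel_measurable ((\<Pi>\<^sub>M e\<in>lower_edges E. lborel) \<Otimes>\<^sub>M (\<Pi>\<^sub>M j\<in>UNIV. lborel))"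
  unfolding row_factor_def matrix_matrix_mult_def transpose_def vec_lambda_beta by measurable

text \<open>The trace formula turns the exponent into a sum over rows, and the indicators multiply
  to the restriction to positive diagonals.\<close>

lemma prod_row_factor:
  "(\<Prod>j\<in>UNIV. row_factor E U \<alpha> j (l, d)) =
     indicator {d. \<forall>j. 0 < d j} d * ennreal (weight U \<alpha> (matrix_inv (tri_of E l), diag_of d))"
proof (cases "\<forall>j. 0 < d j")
  case True
  then have "pos_diagonal (diag_of d)" by (simp add: pos_diagonal_def diag_of_def)
  from trace_LDLt_inverse[OF unit_lower_tri_of this] show ?thesis
    using True
    by (simp add: row_factor_def weight_def prod_ennreal exp_sum[symmetric] diag_of_def sum.distrib
        sum_negf sum_divide_distrib[symmetric])
next
  case False
  then obtain j where "\<not> 0 < d j" by blast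
  then have "row_factor E U \<alpha> j (l, d) = 0" by (simp add: row_factor_def)
  then have "(\<Prod>j\<in>UNIV. row_factor E U \<alpha> j (l, d)) = 0" by (intro prod_zero) auto
  with False show ?thesis by simp
qed

text \<open>The density is pulled back to the free coordinates of \<open>L\<close>, and then
  \<open>l\<close> is replaced by the coordinates of the inverse, which leaves Lebesgue measure
  unchanged.\<close>

lemma emeasure_pi_P:
  fixes E :: "('n::{finite,wellorder}) rel"
  assumes S_H: "in_S_H E" and X: "X \<in> sets (restrict_space borel (cone_P E))"
  shows "emeasure (pi_P E U \<alpha>) X =
    (\<integral>\<^sup>+ (l, d). (\<Prod>j\<in>UNIV. row_factor E U \<alpha> j (l, d)) / z_G E U \<alpha> * indicator X (LDLt (matrix_inv (tri_of E l), diag_of d))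
       \<partial>((\<Pi>\<^sub>M e\<in>lower_edges E. lborel) \<Otimes>\<^sub>M (\<Pi>\<^sub>M j\<in>UNIV. lborel)))"
proof -
  let ?P = "\<Pi>\<^sub>M e\<in>lower_edges E. (lborel :: real measure)" and ?Q = "\<Pi>\<^sub>M j\<in>(UNIV :: 'n set). (lborel :: real measure)"
  interpret P: finite_product_sigma_finite "\<lambda>_. lborel :: real measure" "lower_edges E" by unfold_locales auto
  interpret Q: finite_product_sigma_finite "\<lambda>_. lborel :: real measure" "UNIV :: 'n set" by unfold_locales auto
  interpret PQ: pair_sigma_finite ?P ?Q ..
  let ?C = "restrict_space borel (cone_P E)"
  let ?D = "distr (?P \<Otimes>\<^sub>M ?Q) borel (fill_matrices E)"
  have fill: "fill_matrices E \<in> borel_measurable (?P \<Otimes>\<^sub>M ?Q)"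
  proof -
    have "(\<lambda>x. (tri_of E (fst x), diag_of (snd x))) \<in> borel_measurable (?P \<Otimes>\<^sub>M ?Q)"
      by (intro borel_measurable_Pair) measurable
    then show ?thesis by (simp add: fill_matrices_eq[symmetric])
  qed
  have sets_dLdD: "sets (dLdD E) = sets (restrict_space borel (Theta E))"
    unfolding dLdD_def by (intro sets_restrict_space_cong) simp
  have space_dLdD: "space (dLdD E) = Theta E"
    by (simp add: dLdD_def space_restrict_space)
  have LDLt: "LDLt \<in> measurable (dLdD E) ?C"
    unfolding measurable_cong_sets[OF sets_dLdD refl]
    using LDLt_in_cone_P[OF S_H]
    by (intro measurable_restrict_space2 measurable_restrict_space1 LDLt_borel_measurable)
       (auto simp: space_restrict_space)
  have weight [measurable]: "weight U \<alpha> \<in> borel_measurable (dLdD E)"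
    unfolding measurable_cong_sets[OF sets_dLdD refl]
    using weight_measurable[of "\<lambda>x. x" "restrict_space borel (Theta E)" E U \<alpha>]
    by (simp add: space_restrict_space measurable_restrict_space1)
  define H where "H x = ennreal (weight U \<alpha> x) / z_G E U \<alpha> * indicator (LDLt -` X \<inter> space (dLdD E)) x" for x
  have sets_X: "LDLt -` X \<inter> space (dLdD E) \<in> sets (dLdD E)"
    by (rule measurable_sets[OF LDLt X])
  have "H \<in> borel_measurable (dLdD E)"
    unfolding H_def using sets_X by measurable
  then have "H \<in> borel_measurable (restrict_space ?D (Theta E))"
    by (simp add: dLdD_def)
  then have "(\<lambda>x. H x * indicator (Theta E) x) \<in> borel_measurable ?D"
    by (subst (asm) borel_measurable_restrict_space_iff_ennreal) auto
  then have H: "(\<lambda>x. H x * indicator (Theta E) x) \<in> borel_measurable borel" by simp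
  \<comment> \<open>The integrand in free coordinates; the indicator of \<open>Theta E\<close> takes
    over the restriction of the space.\<close>
  define H' where "H' x = H (fill_matrices E x) * indicator (Theta E) (fill_matrices E x)" for x
  have H'm [measurable]: "H' \<in> borel_measurable (?P \<Otimes>\<^sub>M ?Q)"
    unfolding H'_def by (rule measurable_compose[OF fill H])
  have "emeasure (pi_P E U \<alpha>) X = emeasure (pi_Theta E U \<alpha>) (LDLt -` X \<inter> space (pi_Theta E U \<alpha>))"
    unfolding pi_P_def by (rule emeasure_distr[OF _ X]) (simp add: pi_Theta_def LDLt)
  also have "\<dots> = (\<integral>\<^sup>+ x. H x \<partial>dLdD E)"
    unfolding pi_Theta_def H_def space_density by (rule emeasure_density[OF _ sets_X]) measurable
  also have "\<dots> = (\<integral>\<^sup>+ x. H x * indicator (Theta E) x \<partial>?D)"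
    unfolding dLdD_def by (rule nn_integral_restrict_space) simp
  also have "\<dots> = (\<integral>\<^sup>+ x. H' x \<partial>(?P \<Otimes>\<^sub>M ?Q))"
    unfolding H'_def using H by (intro nn_integral_distr fill) simp
  \<comment> \<open>The integral over \<open>l\<close> is put inside, so that inversion is a change
    of variables at fixed \<open>d\<close>.\<close>
  also have "\<dots> = (\<integral>\<^sup>+ d. (\<integral>\<^sup>+ l. H' (l, d) \<partial>?P) \<partial>?Q)"
    by (rule PQ.nn_integral_snd[symmetric]) measurable
  also have "\<dots> = (\<integral>\<^sup>+ d. (\<integral>\<^sup>+ l. H' (inverse_coords E l, d) \<partial>?P) \<partial>?Q)"
    by (intro nn_integral_cong nn_integral_inverse_coords[symmetric] measurable_Pair1[OF H'm])
  also have "\<dots> = (\<integral>\<^sup>+ x. H' (inverse_coords E (fst x), snd x) \<partial>(?P \<Otimes>\<^sub>M ?Q))"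
  proof -
    have "(\<lambda>x. H' (inverse_coords E (fst x), snd x)) \<in> borel_measurable (?P \<Otimes>\<^sub>M ?Q)"
      by (rule measurable_compose[OF _ H'm]) measurable
    from PQ.nn_integral_snd[OF this] show ?thesis by simp
  qed
  also have "\<dots> = (\<integral>\<^sup>+ (l, d). (\<Prod>j\<in>UNIV. row_factor E U \<alpha> j (l, d)) / z_G E U \<alpha> * indicator X (LDLt (matrix_inv (tri_of E l), diag_of d)) \<partial>(?P \<Otimes>\<^sub>M ?Q))"
  proof (intro nn_integral_cong)
    fix x :: "('n \<times> 'n \<Rightarrow> real) \<times> ('n \<Rightarrow> real)"
    obtain l d where x: "x = (l, d)" by force
    let ?y = "(matrix_inv (tri_of E l), diag_of d)"
    \<comment> \<open>After the substitution \<open>l\<close> describes the inverse, and the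
      Cholesky factor itself is \<open>matrix_inv (tri_of E l)\<close>.\<close>
    have fill_y: "fill_matrices E (inverse_coords E l, d) = ?y"
      by (simp add: fill_matrices_eq tri_of_inverse_coords[OF S_H])
    have "?y \<in> Theta E \<longleftrightarrow> (\<forall>j. 0 < d j)"
      unfolding fill_y[symmetric] by (rule fill_matrices_in_Theta_iff)
    then show "H' (inverse_coords E (fst x), snd x) = (case x of (l, d) \<Rightarrow> (\<Prod>j\<in>UNIV. row_factor E U \<alpha> j (l, d)) / z_G E U \<alpha> * indicator X (LDLt (matrix_inv (tri_of E l), diag_of d)))"
      unfolding x H'_def H_def prod_row_factor space_dLdD
      by (auto simp: fill_y indicator_def)
  qed
  finally show ?thesis .
qed

section \<open>Factorization of joint events\<close>

lemma Int_stable_vimage_sets: "Int_stable {f -` A \<inter> \<Omega> |A. A \<in> sets N}"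
proof (rule Int_stableI)
  fix a b
  assume "a \<in> {f -` A \<inter> \<Omega> |A. A \<in> sets N}" "b \<in> {f -` A \<inter> \<Omega> |A. A \<in> sets N}"
  then obtain A B where "A \<in> sets N" "B \<in> sets N" "a = f -` A \<inter> \<Omega>" "b = f -` B \<inter> \<Omega>" by blast
  then show "a \<inter> b \<in> {f -` A \<inter> \<Omega> |A. A \<in> sets N}"
    by (intro CollectI exI[of _ "A \<inter> B"]) auto
qed

text \<open>Row \<open>i\<close> of the inverse factor together with \<open>d i\<close> separates
  from all other coordinates. The two factors need not be probabilities; normalization is dealt with
  afterwards.\<close>

lemma emeasure_pi_P_factorizes:
  fixes E :: "('n::{finite,wellorder}) rel" and i :: 'n
  assumes S_H: "in_S_H E"
  defines "sub \<equiv> \<lambda>A :: 'n sqmat. \<lambda>(u, v)\<in>{..<i} \<times> {..<i}. A $ u $ v"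
  shows "\<exists>\<phi> \<psi>. \<forall>A\<in>sets borel. \<forall>B\<in>sets (\<Pi>\<^sub>M p\<in>{..<i} \<times> {..<i}. borel).
    emeasure (pi_P E U \<alpha>) {S \<in> cone_P E. ldl_column S i i \<in> A \<and> sub S \<in> B} = \<phi> A * \<psi> B"
proof -
  let ?P = "\<Pi>\<^sub>M e\<in>lower_edges E. (lborel :: real measure)" and ?Q = "\<Pi>\<^sub>M j\<in>(UNIV :: 'n set). (lborel :: real measure)"
  let ?R = "\<Pi>\<^sub>M p\<in>{..<i} \<times> {..<i}. (borel :: real measure)"
  \<comment> \<open>The free coordinates are split by whether they lie in row
    \<open>i\<close>.\<close>
  define I where "I = {e \<in> lower_edges E. fst e \<noteq> i}"
  define J where "J = {e \<in> lower_edges E. fst e = i}"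
  define K where "K = UNIV - {i}"
  have IJ: "lower_edges E = I \<union> J" and UNIV_K: "(UNIV :: 'n set) = insert i K" and disj: "I \<inter> J = {}"
    by (auto simp: I_def J_def K_def)
  define W where "W x = LDLt (matrix_inv (tri_of E (fst x)), diag_of (snd x))" for x
  have W_nth: "W x $ u $ v = (\<Sum>k\<in>UNIV. matrix_inv (tri_of E (fst x)) $ u $ k * snd x k * matrix_inv (tri_of E (fst x)) $ v $ k)" for x u v
    unfolding W_def by (subst LDLt_nth) (auto simp: diag_of_def)
  have sub_W [measurable]: "(\<lambda>x. sub (W x)) \<in> measurable (?P \<Otimes>\<^sub>M ?Q) ?R"
    unfolding sub_def W_nth by (intro measurable_restrict) (auto simp: split_beta)
  have sub_m [measurable]: "sub \<in> measurable borel ?R"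
    unfolding sub_def by (intro measurable_restrict) (auto simp: split_beta)
  \<comment> \<open>The normalizing constant is assigned to \<open>G\<close>; and \<open>F\<close>
    tests \<open>d i\<close> directly, which agrees with \<open>ldl_column\<close> wherever the row
    factors do not vanish.\<close>
  define F where "F A x = row_factor E U \<alpha> i x * indicator A (snd x i)" for A x
  define G where "G B x = (\<Prod>j\<in>K. row_factor E U \<alpha> j x) / z_G E U \<alpha> * indicator B (sub (W x))" for B x
  have F_m: "F A \<in> borel_measurable (?P \<Otimes>\<^sub>M ?Q)" if [measurable]: "A \<in> sets borel" for A
    unfolding F_def by measurable
  have G_m: "G B \<in> borel_measurable (?P \<Otimes>\<^sub>M ?Q)" if [measurable]: "B \<in> sets ?R" for B
    unfolding G_def by measurable
  have F_cong: "F A (l, d) = F A (l', d')" if "\<And>e. e \<in> J \<Longrightarrow> l e = l' e" "d i = d' i" for A l d l' d'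
  proof -
    have "tri_of E l $ i = tri_of E l' $ i"
      using that by (auto simp: tri_of_def J_def vec_eq_iff)
    with that show ?thesis
      by (simp add: F_def row_factor_def matrix_matrix_mult_def transpose_def)
  qed
  have G_cong: "G B (l, d) = G B (l', d')" if "\<And>e. e \<in> I \<Longrightarrow> l e = l' e" "\<And>j. j \<in> K \<Longrightarrow> d j = d' j" for B l d l' d'
  proof -
    have tri: "tri_of E l $ a = tri_of E l' $ a" if "a \<noteq> i" for a
      using that \<open>\<And>e. e \<in> I \<Longrightarrow> l e = l' e\<close> by (auto simp: tri_of_def I_def vec_eq_iff)
    have d: "d j = d' j" if "j \<noteq> i" for j
      using that \<open>\<And>j. j \<in> K \<Longrightarrow> d j = d' j\<close> by (auto simp: K_def)
    have "row_factor E U \<alpha> j (l, d) = row_factor E U \<alpha> j (l', d')" if "j \<in> K" for j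
      using tri[of j] d[of j] that by (simp add: K_def row_factor_def matrix_matrix_mult_def transpose_def)
    moreover have "sub (W (l, d)) = sub (W (l', d'))"
    proof -
      have "W (l, d) $ u $ v = W (l', d') $ u $ v" if "u < i" "v < i" for u v
      proof -
        have inv: "matrix_inv (tri_of E l) $ a $ k = matrix_inv (tri_of E l') $ a $ k" if "a < i" for a k
          using that by (intro matrix_inv_unit_lower_cong unit_lower_tri_of) (auto simp: tri)
        \<comment> \<open>The only term of the entry containing \<open>d i\<close> is the one with
          \<open>k = i\<close>, and it has this zero as a factor because
          \<open>u < i\<close>.\<close>
        have "matrix_inv (tri_of E l') $ u $ i = 0"
          using unit_lower_matrix_inv[OF unit_lower_tri_of, of E l'] \<open>u < i\<close> by (auto simp: unit_lower_def)
        then show ?thesis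
          using that inv unfolding W_nth fst_conv snd_conv
          by (intro sum.cong) (metis d mult_zero_left)+
      qed
      then show ?thesis by (auto simp: sub_def fun_eq_iff)
    qed
    ultimately show ?thesis by (simp add: G_def)
  qed
  have FG: "emeasure (pi_P E U \<alpha>) {S \<in> cone_P E. ldl_column S i i \<in> A \<and> sub S \<in> B} = (\<integral>\<^sup>+ x. F A x * G B x \<partial>(?P \<Otimes>\<^sub>M ?Q))"
    if A [measurable]: "A \<in> sets borel" and B [measurable]: "B \<in> sets ?R" for A B
  proof -
    note [measurable] = ldl_column_measurable
    let ?X = "{S \<in> cone_P E. ldl_column S i i \<in> A \<and> sub S \<in> B}"
    have "{S \<in> space borel. ldl_column S i i \<in> A \<and> sub S \<in> B} \<in> sets borel" by measurable
    then have X: "?X \<in> sets (restrict_space borel (cone_P E))"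
      unfolding sets_restrict_space by (rule rev_image_eqI) auto
    show ?thesis
      unfolding emeasure_pi_P[OF S_H X]
    proof (intro nn_integral_cong)
      fix x :: "('n \<times> 'n \<Rightarrow> real) \<times> ('n \<Rightarrow> real)"
      obtain l d where x: "x = (l, d)" by force
      have prod: "(\<Prod>j\<in>UNIV. row_factor E U \<alpha> j x) = row_factor E U \<alpha> i x * (\<Prod>j\<in>K. row_factor E U \<alpha> j x)"
        unfolding K_def by (rule prod.remove) auto
      have FG_x: "F A x * G B x = (\<Prod>j\<in>UNIV. row_factor E U \<alpha> j x) / z_G E U \<alpha> * (indicator A (d i) * indicator B (sub (W x)))"
        unfolding prod by (simp add: F_def G_def x divide_ennreal_def mult_ac)
      show "(case x of (l, d) \<Rightarrow> (\<Prod>j\<in>UNIV. row_factor E U \<alpha> j (l, d)) / z_G E U \<alpha> * indicator ?X (LDLt (matrix_inv (tri_of E l), diag_of d))) = F A x * G B x"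
      \<comment> \<open>For positive \<open>d\<close> the point is a genuine Cholesky pair, so
        elimination recovers \<open>d i\<close>. Otherwise some row factor is zero and both sides
        vanish.\<close>
      proof (cases "\<forall>j. 0 < d j")
        case True
        have Th: "(matrix_inv (tri_of E l), diag_of d) \<in> Theta E"
          using True fill_matrices_in_Theta_iff[of E "inverse_coords E l" d]
          by (simp add: fill_matrices_eq tri_of_inverse_coords[OF S_H])
        have cone: "W x \<in> cone_P E"
          unfolding W_def x fst_conv snd_conv by (rule LDLt_in_cone_P[OF S_H Th])
        have "modified_cholesky (W x) (matrix_inv (tri_of E l)) (diag_of d)"
          using Th by (auto simp: modified_cholesky_def W_def x Theta_def lower_L_def)
        from ldl_column_LDLt[OF this, of i i] have "ldl_column (W x) i i = d i"
          using unit_lower_matrix_inv[OF unit_lower_tri_of, of E l] by (simp add: unit_lower_def diag_of_def)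
        with cone have "indicator ?X (W x) = (indicator A (d i) * indicator B (sub (W x)) :: ennreal)"
          by (auto simp: indicator_def)
        then show ?thesis unfolding FG_x by (simp add: x W_def)
      next
        case False
        then have "(\<Prod>j\<in>UNIV. row_factor E U \<alpha> j (l, d)) = 0"
          unfolding prod_row_factor by simp
        then show ?thesis
          unfolding FG_x unfolding x by (simp only: split_conv divide_ennreal_def mult_zero_left)
      qed
    qed
  qed
  show ?thesis
  proof (intro exI ballI)
    fix A :: "real set" and B
    assume A: "A \<in> sets borel" and B: "B \<in> sets ?R"
    show "emeasure (pi_P E U \<alpha>) {S \<in> cone_P E. ldl_column S i i \<in> A \<and> sub S \<in> B} =
      (\<integral>\<^sup>+ y. (\<integral>\<^sup>+ t. F A (y, \<lambda>_. t) \<partial>lborel) \<partial>(\<Pi>\<^sub>M e\<in>J. lborel)) * (\<integral>\<^sup>+ x. (\<integral>\<^sup>+ d. G B (x, d) \<partial>(\<Pi>\<^sub>M e\<in>K. lborel)) \<partial>(\<Pi>\<^sub>M e\<in>I. lborel))"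
      unfolding FG[OF A B] unfolding IJ UNIV_K
      by (rule nn_integral_lborel_split[OF _ _ _ disj _ F_m[OF A, unfolded IJ UNIV_K] G_m[OF B, unfolded IJ UNIV_K] F_cong G_cong])
         (auto simp: K_def)
  qed
qed

section \<open>Independence\<close>

theorem corollary1:
  fixes E :: "('n::{finite,wellorder}) rel"
    and U :: "'n sqmat" and \<alpha> :: "(real, 'n) vec"
    and M :: "'w measure" and \<Sigma> L D :: "'w \<Rightarrow> 'n sqmat"
    and i :: 'n
  assumes "sym E" and "irrefl E"
    and "homogeneous_graph E"
    and "in_S_H E"
    and "pos_def U"
    and "\<forall>j. \<alpha> $ j \<ge> 0"
    and "z_G E U \<alpha> < \<infinity>"
    and "prob_space M"
    and "\<Sigma> \<in> measurable M (restrict_space borel (cone_P E))"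
    and "distr M (restrict_space borel (cone_P E)) \<Sigma> = pi_P E U \<alpha>"
    and "\<forall>\<omega>\<in>space M. modified_cholesky (\<Sigma> \<omega>) (L \<omega>) (D \<omega>)"
  shows "prob_space.indep_rv M
           borel
           (\<lambda>\<omega>. D \<omega> $ i $ i)
           (\<Pi>\<^sub>M p\<in>{..<i} \<times> {..<i}. borel)
           (\<lambda>\<omega>. \<lambda>(u, v)\<in>{..<i} \<times> {..<i}. \<Sigma> \<omega> $ u $ v)"
proof -
  interpret prob_space M by fact
  let ?R = "\<Pi>\<^sub>M p\<in>{..<i} \<times> {..<i}. (borel :: real measure)"
  define sub where "sub = (\<lambda>A :: 'n sqmat. \<lambda>(u, v)\<in>{..<i} \<times> {..<i}. A $ u $ v)"
  note \<Sigma> = assms(9)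
  have \<Sigma>' [measurable]: "\<Sigma> \<in> borel_measurable M"
    using \<Sigma> by (simp add: measurable_restrict_space2_iff)
  have cone: "\<Sigma> \<omega> \<in> cone_P E" if "\<omega> \<in> space M" for \<omega>
    using measurable_space[OF \<Sigma> that] by (simp add: space_restrict_space)
  \<comment> \<open>Elimination expresses the entry as a Borel function of \<open>\<Sigma>\<close>,
    which supplies its measurability and turns events about it into events about
    \<open>\<Sigma>\<close>.\<close>
  have D_eq: "D \<omega> $ i $ i = ldl_column (\<Sigma> \<omega>) i i" if "\<omega> \<in> space M" for \<omega>
    using assms(11) that ldl_column_LDLt[of "\<Sigma> \<omega>" "L \<omega>" "D \<omega>" i i]
    by (auto simp: modified_cholesky_def unit_lower_def)
  have D_m: "(\<lambda>\<omega>. D \<omega> $ i $ i) \<in> borel_measurable M"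
    by (subst measurable_cong[OF D_eq]) (use measurable_compose[OF \<Sigma>' ldl_column_measurable] in auto)
  have sub_borel [measurable]: "sub \<in> measurable borel ?R"
    unfolding sub_def by (intro measurable_restrict) (auto simp: split_beta)
  have sub_m: "(\<lambda>\<omega>. sub (\<Sigma> \<omega>)) \<in> measurable M ?R"
    by measurable
  obtain \<phi> \<psi> where factor: "\<And>A B. A \<in> sets borel \<Longrightarrow> B \<in> sets ?R \<Longrightarrow>
      emeasure (pi_P E U \<alpha>) {S \<in> cone_P E. ldl_column S i i \<in> A \<and> sub S \<in> B} = \<phi> A * \<psi> B"
    using emeasure_pi_P_factorizes[OF assms(4), of i U \<alpha>] unfolding sub_def by blast
  have event: "emeasure M {\<omega> \<in> space M. D \<omega> $ i $ i \<in> A \<and> sub (\<Sigma> \<omega>) \<in> B} = \<phi> A * \<psi> B"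
    if A [measurable]: "A \<in> sets borel" and B [measurable]: "B \<in> sets ?R" for A B
  proof -
    note [measurable] = ldl_column_measurable
    let ?X = "{S \<in> cone_P E. ldl_column S i i \<in> A \<and> sub S \<in> B}"
    have "{S \<in> space borel. ldl_column S i i \<in> A \<and> sub S \<in> B} \<in> sets borel" by measurable
    then have X: "?X \<in> sets (restrict_space borel (cone_P E))"
      unfolding sets_restrict_space by (rule rev_image_eqI) auto
    have "{\<omega> \<in> space M. D \<omega> $ i $ i \<in> A \<and> sub (\<Sigma> \<omega>) \<in> B} = \<Sigma> -` ?X \<inter> space M"
      using D_eq cone by auto
    then show ?thesis
      using emeasure_distr[OF \<Sigma> X] factor[OF A B] assms(10) by simp
  qed
  \<comment> \<open>Taking one of the two sets to be the whole space gives the marginals, and taking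
    both gives total mass 1. The unnormalized factors then cancel by regrouping.\<close>
  have prob_eq: "prob {\<omega> \<in> space M. D \<omega> $ i $ i \<in> A \<and> sub (\<Sigma> \<omega>) \<in> B} =
      prob {\<omega> \<in> space M. D \<omega> $ i $ i \<in> A} * prob {\<omega> \<in> space M. sub (\<Sigma> \<omega>) \<in> B}"
    if A: "A \<in> sets borel" and B: "B \<in> sets ?R" for A B
  proof -
    have sub_space: "sub (\<Sigma> \<omega>) \<in> space ?R" for \<omega>
      by (auto simp: sub_def space_PiM)
    have 1: "emeasure M {\<omega> \<in> space M. D \<omega> $ i $ i \<in> A} = \<phi> A * \<psi> (space ?R)"
      using event[OF A, of "space ?R"] sub_space by simp
    have 2: "emeasure M {\<omega> \<in> space M. sub (\<Sigma> \<omega>) \<in> B} = \<phi> UNIV * \<psi> B"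
      using event[OF _ B, of UNIV] by simp
    have 3: "1 = \<phi> UNIV * \<psi> (space ?R)"
      using event[of UNIV "space ?R"] sub_space emeasure_space_1 by simp
    have "\<phi> A * \<psi> B = (\<phi> A * \<psi> B) * (\<phi> UNIV * \<psi> (space ?R))"
      using 3 by simp
    also have "\<dots> = (\<phi> A * \<psi> (space ?R)) * (\<phi> UNIV * \<psi> B)"
      by (simp add: mult_ac)
    finally show ?thesis
      using event[OF A B] 1 2 by (simp add: measure_def enn2real_mult)
  qed
  have "indep_set {(\<lambda>\<omega>. D \<omega> $ i $ i) -` A \<inter> space M |A. A \<in> sets borel}
      {(\<lambda>\<omega>. sub (\<Sigma> \<omega>)) -` B \<inter> space M |B. B \<in> sets ?R}"
    unfolding indep_sets2_eq
  proof (intro conjI ballI)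
    show "{(\<lambda>\<omega>. D \<omega> $ i $ i) -` A \<inter> space M |A. A \<in> sets borel} \<subseteq> events"
      using D_m by (auto intro: measurable_sets)
    show "{(\<lambda>\<omega>. sub (\<Sigma> \<omega>)) -` B \<inter> space M |B. B \<in> sets ?R} \<subseteq> events"
      using sub_m by (auto intro: measurable_sets)
    fix a b
    assume "a \<in> {(\<lambda>\<omega>. D \<omega> $ i $ i) -` A \<inter> space M |A. A \<in> sets borel}"
      and "b \<in> {(\<lambda>\<omega>. sub (\<Sigma> \<omega>)) -` B \<inter> space M |B. B \<in> sets ?R}"
    then obtain A B where AB: "A \<in> sets borel" "B \<in> sets ?R"
      and a: "a = {\<omega> \<in> space M. D \<omega> $ i $ i \<in> A}" and b: "b = {\<omega> \<in> space M. sub (\<Sigma> \<omega>) \<in> B}"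
      by auto
    have "a \<inter> b = {\<omega> \<in> space M. D \<omega> $ i $ i \<in> A \<and> sub (\<Sigma> \<omega>) \<in> B}"
      by (auto simp: a b)
    with prob_eq[OF AB] show "prob (a \<inter> b) = prob a * prob b" by (simp add: a b)
  qed
  \<comment> \<open>The preimages form intersection-stable generators, so independence extends to
    the generated sigma-algebras.\<close>
  then have "indep_rv borel (\<lambda>\<omega>. D \<omega> $ i $ i) ?R (\<lambda>\<omega>. sub (\<Sigma> \<omega>))"
    unfolding indep_rv_def using D_m sub_m
    by (intro conjI indep_set_sigma_sets Int_stable_vimage_sets)
  then show ?thesis by (simp add: sub_def)
qed

end
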